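(* Let $\Gamma$ be a discrete group with identity $e$, $G$ a locally compact, Hausdorff groupoid with totally disconnected unit space such that $s : G \to G^{(0)}$ is a local homeomorphism, and $c : G \to \Gamma$ a continuous cocycle. Suppose that $\{u \in G^{(0)} : uG_e u = \{u\}\}$ is dense in $G^{(0)}$. Let $B$ be a $\Gamma$-graded complex algebra, let $\pi : A(G) \to B$ be a graded homomorphism, and suppose that $\ker(\pi) \neq \{0\}$. Then there is a nonempty compact open subset $K \subseteq G^{(0)}$ such that $\pi(1_K) = 0$.
   Context: A groupoid is a small category with inverses; a topological groupoid carries a topology making range $r$, source $s$, inversion and composition continuous. $G^{(0)}$ is the unit space; "totally disconnected" means it has a basis of clopen sets. A continuous cocycle $c:G\to\Gamma$ is a continuous map with $c(\alpha\beta)=c(\alpha)c(\beta)$ for composable $\alpha,\beta$. For $n\in\Gamma$, $G_n:=c^{-1}(n)$; for a unit $u$, $uG_eu:=\{\alpha\in G_e:r(\alpha)=s(\alpha)=u\}$. For a function $f$, $\operatorname{supp}(f):=\{x: f(x)\neq 0\}$; $C_c(G)$ is the space of continuous compactly supported functions $G\to\mathbb{C}$. A function is locally constant if every point has a neighbourhood on which it is constant. $A_n:=\{f\in C_c(G): \operatorname{supp}(f)\subseteq G_n,\ f \text{ locally constant}\}$, and $A(G):=\operatorname{span}\{A_n:n\in\Gamma\}\subseteq C_c(G)$, a $\Gamma$-graded complex algebra with graded subspaces $A_n$ under $(f*g)(\gamma)=\sum_{r(\alpha)=r(\gamma)}f(\alpha)g(\alpha^{-1}\gamma)$. A $\Gamma$-graded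 complex algebra is a complex algebra $B=\bigoplus_{n\in\Gamma}B_n$ with $B_mB_n\subseteq B_{mn}$. A graded homomorphism $\pi:A(G)\to B$ is an algebra homomorphism with $\pi(A_n)\subseteq B_n$ for all $n$. $1_K$ is the indicator function of $K$ regarded as a function on $G$ ($G^{(0)}$ is open in $G$). *)

theory Defs
  imports
    "HOL-Analysis.Analysis"
    "HOL-Algebra.Group"
    "HOL-Library.Function_Algebras"
begin

section \<open>Topological groupoids\<close>

text \<open>
  A groupoid is identified with its set of arrows, the topological space \<open>Top G\<close>; units are the
  identity arrows.  The operations are total functions of which only the values on arrows (and,
  for \<open>mult\<close>, on composable pairs) matter.
\<close>

record 'g topgroupoid =
  Top :: "'g topology"
  rng :: "'g \<Rightarrow> 'g"
  src :: "'g \<Rightarrow> 'g"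
  ginv :: "'g \<Rightarrow> 'g"
  mult :: "'g \<Rightarrow> 'g \<Rightarrow> 'g"

abbreviation arrows :: "'g topgroupoid \<Rightarrow> 'g set" where
  "arrows G \<equiv> topspace (Top G)"

definition units :: "'g topgroupoid \<Rightarrow> 'g set" where
  "units G = rng G ` arrows G"

abbreviation unit_space :: "'g topgroupoid \<Rightarrow> 'g topology" where
  "unit_space G \<equiv> subtopology (Top G) (units G)"

definition composable :: "'g topgroupoid \<Rightarrow> ('g \<times> 'g) set" where
  "composable G = {(a, b). a \<in> arrows G \<and> b \<in> arrows G \<and> src G a = rng G b}"

locale groupoid =
  fixes G :: "'g topgroupoid"
  assumes rng_closed: "a \<in> arrows G \<Longrightarrow> rng G a \<in> arrows G"
    and src_closed: "a \<in> arrows G \<Longrightarrow> src G a \<in> arrows G"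
    and ginv_closed: "a \<in> arrows G \<Longrightarrow> ginv G a \<in> arrows G"
    and mult_closed: "(a, b) \<in> composable G \<Longrightarrow> mult G a b \<in> arrows G"
    and rng_rng: "a \<in> arrows G \<Longrightarrow> rng G (rng G a) = rng G a"
    and src_rng: "a \<in> arrows G \<Longrightarrow> src G (rng G a) = rng G a"
    and rng_src: "a \<in> arrows G \<Longrightarrow> rng G (src G a) = src G a"
    and src_src: "a \<in> arrows G \<Longrightarrow> src G (src G a) = src G a"
    and rng_mult: "(a, b) \<in> composable G \<Longrightarrow> rng G (mult G a b) = rng G a"
    and src_mult: "(a, b) \<in> composable G \<Longrightarrow> src G (mult G a b) = src G b"
    and mult_assoc: "\<lbrakk>(a, b) \<in> composable G; (b, d) \<in> composable G\<rbrakk>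
      \<Longrightarrow> mult G (mult G a b) d = mult G a (mult G b d)"
    and rng_mult_id: "a \<in> arrows G \<Longrightarrow> mult G (rng G a) a = a"
    and mult_src_id: "a \<in> arrows G \<Longrightarrow> mult G a (src G a) = a"
    and rng_ginv: "a \<in> arrows G \<Longrightarrow> rng G (ginv G a) = src G a"
    and src_ginv: "a \<in> arrows G \<Longrightarrow> src G (ginv G a) = rng G a"
    and mult_ginv: "a \<in> arrows G \<Longrightarrow> mult G a (ginv G a) = rng G a"
    and ginv_mult: "a \<in> arrows G \<Longrightarrow> mult G (ginv G a) a = src G a"

locale topological_groupoid = groupoid +
  assumes continuous_rng: "continuous_map (Top G) (Top G) (rng G)"
    and continuous_src: "continuous_map (Top G) (Top G) (src G)"
    and continuous_ginv: "continuous_map (Top G) (Top G) (ginv G)"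
    and continuous_mult:
      "continuous_map (subtopology (prod_topology (Top G) (Top G)) (composable G)) (Top G)
         (\<lambda>(a, b). mult G a b)"

definition local_homeomorphism :: "'a topology \<Rightarrow> 'b topology \<Rightarrow> ('a \<Rightarrow> 'b) \<Rightarrow> bool" where
  "local_homeomorphism X Y f \<longleftrightarrow>
     (\<forall>x \<in> topspace X. \<exists>U. openin X U \<and> x \<in> U \<and> openin Y (f ` U) \<and>
        homeomorphic_map (subtopology X U) (subtopology Y (f ` U)) f)"

definition has_clopen_basis :: "'a topology \<Rightarrow> bool" where
  "has_clopen_basis X \<longleftrightarrow>
     (\<exists>\<B>. (\<forall>U \<in> \<B>. openin X U \<and> closedin X U) \<and> openin X = arbitrary union_of (\<lambda>U. U \<in> \<B>))"

definition continuous_cocycle ::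
    "'g topgroupoid \<Rightarrow> ('n, 'm) monoid_scheme \<Rightarrow> ('g \<Rightarrow> 'n) \<Rightarrow> bool" where
  "continuous_cocycle G \<Gamma> c \<longleftrightarrow>
     continuous_map (Top G) (discrete_topology (carrier \<Gamma>)) c \<and>
     (\<forall>(a, b) \<in> composable G. c (mult G a b) = c a \<otimes>\<^bsub>\<Gamma>\<^esub> c b)"

definition fibre :: "'g topgroupoid \<Rightarrow> ('g \<Rightarrow> 'n) \<Rightarrow> 'n \<Rightarrow> 'g set" where
  "fibre G c n = {a \<in> arrows G. c a = n}"

text \<open>The set \<open>u H u\<close> for a set \<open>H\<close> of arrows.\<close>

definition isotropy :: "'g topgroupoid \<Rightarrow> 'g set \<Rightarrow> 'g \<Rightarrow> 'g set" where
  "isotropy G H u = {a \<in> H. rng G a = u \<and> src G a = u}"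

section \<open>The algebra \<open>A(G)\<close>\<close>

text \<open>
  Complex functions on the groupoid are represented by functions on the whole type that vanish
  outside the set of arrows.
\<close>

definition cscale :: "complex \<Rightarrow> ('g \<Rightarrow> complex) \<Rightarrow> 'g \<Rightarrow> complex" where
  "cscale z f = (\<lambda>x. z * f x)"

interpretation cfun: vector_space cscale
  by unfold_locales (auto simp: cscale_def fun_eq_iff algebra_simps)

definition supp :: "('g \<Rightarrow> complex) \<Rightarrow> 'g set" where
  "supp f = {x. f x \<noteq> 0}"

definition Cc :: "'g topology \<Rightarrow> ('g \<Rightarrow> complex) set" where
  "Cc X = {f. supp f \<subseteq> topspace X \<and> continuous_map X euclidean f \<and> compactin X (X closure_of supp f)}"

definition locally_constant :: "'g topology \<Rightarrow> ('g \<Rightarrow> complex) \<Rightarrow> bool" where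
  "locally_constant X f \<longleftrightarrow>
     (\<forall>x \<in> topspace X. \<exists>U. openin X U \<and> x \<in> U \<and> (\<forall>y \<in> U. f y = f x))"

definition A_comp :: "'g topgroupoid \<Rightarrow> ('g \<Rightarrow> 'n) \<Rightarrow> 'n \<Rightarrow> ('g \<Rightarrow> complex) set" where
  "A_comp G c n = {f \<in> Cc (Top G). supp f \<subseteq> fibre G c n \<and> locally_constant (Top G) f}"

definition A_alg ::
    "'g topgroupoid \<Rightarrow> ('n, 'm) monoid_scheme \<Rightarrow> ('g \<Rightarrow> 'n) \<Rightarrow> ('g \<Rightarrow> complex) set" where
  "A_alg G \<Gamma> c = cfun.span (\<Union>n \<in> carrier \<Gamma>. A_comp G c n)"

text \<open>
  The index set in the convolution is cut down to the nonzero terms, which are finitely many for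
  compactly supported functions when the source map is a local homeomorphism; over the possibly
  infinite set of all arrows \<open>a\<close> with range \<open>rng G x\<close>, the library's finite sum would be \<open>0\<close>.
\<close>

definition convolution ::
    "'g topgroupoid \<Rightarrow> ('g \<Rightarrow> complex) \<Rightarrow> ('g \<Rightarrow> complex) \<Rightarrow> 'g \<Rightarrow> complex" where
  "convolution G f g x =
     (if x \<in> arrows G
      then \<Sum>a | a \<in> arrows G \<and> rng G a = rng G x \<and> f a * g (mult G (ginv G a) x) \<noteq> 0.
             f a * g (mult G (ginv G a) x)
      else 0)"

section \<open>Graded complex algebras and graded homomorphisms\<close>

text \<open>Algebras are associative but not assumed to be unital.\<close>

locale complex_algebra = vector_space smul
  for smul :: "complex \<Rightarrow> 'b::ring \<Rightarrow> 'b" +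
  assumes mult_scale_left: "smul z x * y = smul z (x * y)"
    and mult_scale_right: "x * smul z y = smul z (x * y)"

locale graded_complex_algebra = complex_algebra smul + group \<Gamma>
  for \<Gamma> :: "('n, 'm) monoid_scheme" and smul :: "complex \<Rightarrow> 'b::ring \<Rightarrow> 'b" +
  fixes B :: "'n \<Rightarrow> 'b set"
  assumes subspace_component: "n \<in> carrier \<Gamma> \<Longrightarrow> subspace (B n)"
    and direct_sum: "\<exists>!x. (\<forall>n \<in> carrier \<Gamma>. x n \<in> B n) \<and> (\<forall>n. n \<notin> carrier \<Gamma> \<longrightarrow> x n = 0) \<and>
      finite {n. x n \<noteq> 0} \<and> b = (\<Sum>n | x n \<noteq> 0. x n)"
    and mult_component: "\<lbrakk>m \<in> carrier \<Gamma>; n \<in> carrier \<Gamma>; x \<in> B m; y \<in> B n\<rbrakk>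
      \<Longrightarrow> x * y \<in> B (m \<otimes>\<^bsub>\<Gamma>\<^esub> n)"

text \<open>The values of \<open>\<pi>\<close> outside \<open>A(G)\<close> are irrelevant.\<close>

definition graded_hom ::
    "'g topgroupoid \<Rightarrow> ('n, 'm) monoid_scheme \<Rightarrow> ('g \<Rightarrow> 'n) \<Rightarrow>
     (complex \<Rightarrow> 'b::ring \<Rightarrow> 'b) \<Rightarrow> ('n \<Rightarrow> 'b set) \<Rightarrow> (('g \<Rightarrow> complex) \<Rightarrow> 'b) \<Rightarrow> bool" where
  "graded_hom G \<Gamma> c smul B \<pi> \<longleftrightarrow>
     (\<forall>f \<in> A_alg G \<Gamma> c. \<forall>g \<in> A_alg G \<Gamma> c. \<pi> (f + g) = \<pi> f + \<pi> g) \<and>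
     (\<forall>z. \<forall>f \<in> A_alg G \<Gamma> c. \<pi> (cscale z f) = smul z (\<pi> f)) \<and>
     (\<forall>f \<in> A_alg G \<Gamma> c. \<forall>g \<in> A_alg G \<Gamma> c. \<pi> (convolution G f g) = \<pi> f * \<pi> g) \<and>
     (\<forall>n \<in> carrier \<Gamma>. \<pi> ` A_comp G c n \<subseteq> B n)"

definition ker ::
    "'g topgroupoid \<Rightarrow> ('n, 'm) monoid_scheme \<Rightarrow> ('g \<Rightarrow> 'n) \<Rightarrow>
     (('g \<Rightarrow> complex) \<Rightarrow> 'b::ring) \<Rightarrow> ('g \<Rightarrow> complex) set" where
  "ker G \<Gamma> c \<pi> = {f \<in> A_alg G \<Gamma> c. \<pi> f = 0}"

end

theory Submission
  imports Defs
begin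

text \<open>
  Grading turns a nonzero element of the kernel into a nonzero \<open>g \<in> A\<^sub>n\<close> in the kernel.  The
  source map is open, so some \<open>x\<close> with \<open>g x \<noteq> 0\<close> has a source with trivial isotropy in \<open>G\<^sub>e\<close>;
  then \<open>x\<close> is the only arrow of \<open>supp g\<close> with its range and source.  By compactness there are
  compact open sets of units \<open>K \<ni> r x\<close>, \<open>L \<ni> s x\<close> such that \<open>1\<^sub>K * g * 1\<^sub>L\<close> is a nonzero multiple
  of \<open>1\<^sub>V\<close> for a compact open bisection \<open>V\<close>.  So \<open>1\<^sub>V\<close> lies in the kernel, and multiplying it by
  the indicator function of \<open>V\<^sup>-\<^sup>1\<close> gives that of \<open>s(V)\<close>, which is compact open.
\<close>

section \<open>Groupoids\<close>

context groupoid
begin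

lemma units_iff: "u \<in> units G \<longleftrightarrow> u \<in> arrows G \<and> rng G u = u"
  unfolding units_def using rng_closed rng_rng by force

lemma units_subset: "units G \<subseteq> arrows G"
  by (auto simp: units_iff)

lemma src_unit: "u \<in> units G \<Longrightarrow> src G u = u"
  using units_iff src_rng by metis

lemma rng_in_units: "a \<in> arrows G \<Longrightarrow> rng G a \<in> units G"
  by (auto simp: units_def)

lemma src_in_units: "a \<in> arrows G \<Longrightarrow> src G a \<in> units G"
  by (simp add: units_iff src_closed rng_src)

lemma ginv_unit: "u \<in> units G \<Longrightarrow> ginv G u = u"
  by (metis ginv_closed mult_ginv rng_ginv rng_mult_id src_unit units_iff)

text \<open>Associativity evaluates the triple product of \<open>?j\<close>, \<open>?i\<close> and
  \<open>a\<close> in two ways: bracketed to the left it collapses to \<open>a\<close>, bracketed to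
  the right to \<open>?j\<close>.\<close>

lemma ginv_ginv:
  assumes a: "a \<in> arrows G"
  shows "ginv G (ginv G a) = a"
proof -
  let ?i = "ginv G a" and ?j = "ginv G (ginv G a)"
  have i: "?i \<in> arrows G" and j: "?j \<in> arrows G"
    using a ginv_closed by auto
  have "mult G (mult G ?j ?i) a = mult G ?j (mult G ?i a)"
    by (rule mult_assoc) (auto simp: composable_def a i j src_ginv rng_ginv)
  moreover have "mult G (mult G ?j ?i) a = a"
    using ginv_mult[OF i] src_ginv[OF a] rng_mult_id[OF a] by simp
  moreover have "mult G ?j (mult G ?i a) = ?j"
    using ginv_mult[OF a] mult_src_id[OF j] src_ginv[OF i] rng_ginv[OF a] by simp
  ultimately show ?thesis by simp
qed

lemma composable_ginv:
  assumes "a \<in> arrows G" "x \<in> arrows G" "rng G a = rng G x"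
  shows "(ginv G a, x) \<in> composable G"
  using assms by (simp add: composable_def ginv_closed src_ginv)

lemma mult_ginv_mult:
  assumes "a \<in> arrows G" "x \<in> arrows G" "rng G a = rng G x"
  shows "mult G a (mult G (ginv G a) x) = x"
proof -
  have "mult G (mult G a (ginv G a)) x = mult G a (mult G (ginv G a) x)"
    by (rule mult_assoc) (auto simp: composable_def assms ginv_closed rng_ginv src_ginv)
  then show ?thesis
    using assms by (simp add: mult_ginv rng_mult_id)
qed

lemma ginv_mult_mult:
  assumes "(a, x) \<in> composable G"
  shows "mult G (ginv G a) (mult G a x) = x"
proof -
  have a: "a \<in> arrows G" and x: "x \<in> arrows G" and eq: "src G a = rng G x"
    using assms by (auto simp: composable_def)
  have "mult G (mult G (ginv G a) a) x = mult G (ginv G a) (mult G a x)"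
    by (rule mult_assoc) (auto simp: composable_def a x eq ginv_closed rng_ginv src_ginv)
  then show ?thesis
    using a x eq by (simp add: ginv_mult rng_mult_id)
qed

section \<open>Convolution with indicator functions\<close>

text \<open>By uniqueness the index set lies in \<open>{b}\<close>, so it is finite. It may be
  empty: the term at \<open>b\<close> is then zero and the formula still holds.\<close>

lemma convolution_eq_single:
  assumes x: "x \<in> arrows G" and b: "b \<in> arrows G" "rng G b = rng G x"
    and unique: "\<And>a. \<lbrakk>a \<in> arrows G; rng G a = rng G x; f a * g (mult G (ginv G a) x) \<noteq> 0\<rbrakk> \<Longrightarrow> a = b"
  shows "convolution G f g x = f b * g (mult G (ginv G b) x)"
proof -
  have "(\<Sum>a | a \<in> arrows G \<and> rng G a = rng G x \<and> f a * g (mult G (ginv G a) x) \<noteq> 0.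
      f a * g (mult G (ginv G a) x)) = (\<Sum>a\<in>{b}. f a * g (mult G (ginv G a) x))"
  proof (rule sum.mono_neutral_left)
    show "{a. a \<in> arrows G \<and> rng G a = rng G x \<and> f a * g (mult G (ginv G a) x) \<noteq> 0} \<subseteq> {b}"
      using unique by blast
  qed (use b in blast)+
  then show ?thesis
    using x by (simp add: convolution_def)
qed

lemma convolution_eq_0:
  assumes "\<And>a. \<lbrakk>x \<in> arrows G; rng G a = rng G x\<rbrakk> \<Longrightarrow> f a * g (mult G (ginv G a) x) = 0"
  shows "convolution G f g x = 0"
proof -
  have "(\<Sum>a | a \<in> arrows G \<and> rng G a = rng G x \<and> f a * g (mult G (ginv G a) x) \<noteq> 0.
      f a * g (mult G (ginv G a) x)) = 0" if "x \<in> arrows G"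
    using assms[OF that] by (intro sum.neutral) blast
  then show ?thesis unfolding convolution_def by presburger
qed

text \<open>A contributing \<open>a\<close> is a unit with range \<open>rng G x\<close>, hence
  \<open>rng G x\<close> itself. Convolving on the left therefore cuts \<open>f\<close> down to the
  arrows with range in \<open>K\<close>.\<close>

lemma convolution_indicator_left:
  assumes K: "K \<subseteq> units G" and f: "supp f \<subseteq> arrows G"
  shows "convolution G (indicator K) f = (\<lambda>x. indicator K (rng G x) * f x)"
proof
  fix x
  show "convolution G (indicator K) f x = indicator K (rng G x) * f x"
  proof (cases "x \<in> arrows G")
    case True
    have "convolution G (indicator K) f x
        = indicator K (rng G x) * f (mult G (ginv G (rng G x)) x)"
      using K by (intro convolution_eq_single)
        (auto simp: True rng_closed rng_rng units_iff indicator_def split: if_splits)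
    then show ?thesis
      using True by (simp add: ginv_unit rng_in_units rng_mult_id)
  next
    case False
    then show ?thesis
      using f by (auto simp: convolution_def supp_def)
  qed
qed

text \<open>A contributing \<open>a\<close> makes \<open>mult G (ginv G a) x\<close> a unit, which
  must be \<open>src G a\<close>; multiplying by \<open>a\<close> gives
  \<open>a = x\<close>.\<close>

lemma convolution_indicator_right:
  assumes K: "K \<subseteq> units G" and f: "supp f \<subseteq> arrows G"
  shows "convolution G f (indicator K) = (\<lambda>x. f x * indicator K (src G x))"
proof
  fix x
  show "convolution G f (indicator K) x = f x * indicator K (src G x)"
  proof (cases "x \<in> arrows G")
    case True
    have "convolution G f (indicator K) x = f x * indicator K (mult G (ginv G x) x)"
    proof (rule convolution_eq_single)
      fix a
      assume a: "a \<in> arrows G" "rng G a = rng G x"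
        and nz: "f a * indicator K (mult G (ginv G a) x) \<noteq> 0"
      have "mult G (ginv G a) x \<in> units G"
        using nz K by (auto simp: indicator_def split: if_splits)
      then have "mult G (ginv G a) x = rng G (mult G (ginv G a) x)"
        by (simp add: units_iff)
      also have "\<dots> = src G a"
        using a True by (simp add: rng_mult[OF composable_ginv] rng_ginv)
      finally show "a = x"
        using mult_ginv_mult[OF a(1) True a(2)] mult_src_id[OF a(1)] by simp
    qed (use True in auto)
    then show ?thesis
      using True by (simp add: ginv_mult)
  next
    case False
    then show ?thesis
      using f by (auto simp: convolution_def supp_def)
  qed
qed

text \<open>A contributing \<open>a\<close> is the inverse of some \<open>b\<close> in
  \<open>V\<close> with \<open>b y\<close> in \<open>V\<close>. As \<open>b y\<close> and
  \<open>b\<close> have the same range, \<open>b y = b\<close>, so \<open>y\<close> is the source of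
  \<open>b\<close>. Injectivity of the source then leaves one such \<open>b\<close>, with term
  1.\<close>

lemma convolution_indicator_ginv:
  assumes V: "V \<subseteq> arrows G" and inj_r: "inj_on (rng G) V" and inj_s: "inj_on (src G) V"
  shows "convolution G (indicator (ginv G ` V)) (indicator V) = indicator (src G ` V)"
proof
  fix y
  let ?t = "\<lambda>a. indicator (ginv G ` V) a * (indicator V (mult G (ginv G a) y) :: complex)"
  have key: "\<exists>b\<in>V. a = ginv G b \<and> y = src G b"
    if y: "y \<in> arrows G" and r: "rng G a = rng G y" and nz: "?t a \<noteq> 0" for a
  proof -
    obtain b where b: "b \<in> V" "a = ginv G b"
      using nz by (auto simp: indicator_def split: if_splits)
    have bG: "b \<in> arrows G" using b V by auto
    have by_V: "mult G b y \<in> V"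
      using nz b bG by (auto simp: indicator_def ginv_ginv split: if_splits)
    have comp: "(b, y) \<in> composable G"
      using bG y r b by (simp add: composable_def rng_ginv)
    have "mult G b y = b"
      using inj_r by_V b rng_mult[OF comp] by (auto dest: inj_onD)
    then have "y = src G b"
      using ginv_mult_mult[OF comp] ginv_mult[OF bG] by simp
    then show ?thesis using b by auto
  qed
  show "convolution G (indicator (ginv G ` V)) (indicator V) y = indicator (src G ` V) y"
  proof (cases "y \<in> src G ` V")
    case True
    then obtain b where b: "b \<in> V" "y = src G b" by auto
    have bG: "b \<in> arrows G" using b V by auto
    have y: "y \<in> arrows G" "rng G y = y"
      using b bG by (simp_all add: src_closed rng_src)
    have "convolution G (indicator (ginv G ` V)) (indicator V) y = ?t (ginv G b)"
    proof (rule convolution_eq_single)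
      fix a assume "a \<in> arrows G" "rng G a = rng G y" "?t a \<noteq> 0"
      then show "a = ginv G b"
        using key[OF y(1)] b inj_s by (metis inj_onD)
    qed (use y b bG in \<open>auto simp: ginv_closed rng_ginv\<close>)
    also have "\<dots> = 1"
      using b bG by (simp add: ginv_ginv mult_src_id)
    finally show ?thesis using True by simp
  next
    case False
    have "convolution G (indicator (ginv G ` V)) (indicator V) y = 0"
    proof (rule convolution_eq_0, rule ccontr)
      fix a assume "y \<in> arrows G" "rng G a = rng G y" "?t a \<noteq> 0"
      from key[OF this] False show False by blast
    qed
    then show ?thesis using False by simp
  qed
qed

end

section \<open>Locally constant functions with compact support\<close>

text \<open>The predicate \<open>P\<close> is arbitrary so that one lemma serves supports, their
  complements and preimages of open sets. Passing \<open>S\<close> by an equation lets it be any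
  other form of the same set.\<close>

lemma locally_constant_openin:
  assumes f: "locally_constant X f" and S: "S = {x \<in> topspace X. P (f x)}"
  shows "openin X S"
proof (subst openin_subopen, intro ballI)
  fix x assume "x \<in> S"
  then obtain U where "openin X U" "x \<in> U" "\<forall>y\<in>U. f y = f x"
    using f S unfolding locally_constant_def by blast
  then show "\<exists>T. openin X T \<and> x \<in> T \<and> T \<subseteq> S"
    using \<open>x \<in> S\<close> S openin_subset by (intro exI[of _ U]) fastforce
qed

lemma locally_constant_closedin:
  assumes f: "locally_constant X f" and S: "S = {x \<in> topspace X. P (f x)}"
  shows "closedin X S"
proof -
  have "openin X (topspace X - S)"
    by (rule locally_constant_openin[OF f, where P = "\<lambda>z. \<not> P z"]) (auto simp: S)
  then show ?thesis by (auto simp: closedin_def S)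
qed

lemma supp_locally_constant:
  assumes "locally_constant X f" "supp f \<subseteq> topspace X"
  shows "openin X (supp f)" "closedin X (supp f)"
proof -
  have S: "supp f = {x \<in> topspace X. f x \<noteq> 0}"
    using assms(2) by (auto simp: supp_def)
  show "openin X (supp f)" "closedin X (supp f)"
    using locally_constant_openin[OF assms(1) S] locally_constant_closedin[OF assms(1) S] .
qed

text \<open>Local constancy makes every preimage open, which gives continuity, and makes the support
  closed, so that taking its closure changes nothing.\<close>

lemma A_comp_iff:
  "f \<in> A_comp G c n \<longleftrightarrow>
     supp f \<subseteq> fibre G c n \<and> locally_constant (Top G) f \<and> compactin (Top G) (supp f)"
proof
  assume f: "f \<in> A_comp G c n"
  then have *: "supp f \<subseteq> arrows G" "locally_constant (Top G) f"
    "compactin (Top G) (Top G closure_of supp f)" "supp f \<subseteq> fibre G c n"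
    by (auto simp: A_comp_def Cc_def)
  then show "supp f \<subseteq> fibre G c n \<and> locally_constant (Top G) f \<and> compactin (Top G) (supp f)"
    using supp_locally_constant(2)[OF *(2,1)] by (simp add: closure_of_closedin)
next
  assume "supp f \<subseteq> fibre G c n \<and> locally_constant (Top G) f \<and> compactin (Top G) (supp f)"
  then have f: "supp f \<subseteq> fibre G c n" "locally_constant (Top G) f" "compactin (Top G) (supp f)"
    by auto
  have sub: "supp f \<subseteq> arrows G" using f(3) by (rule compactin_subset_topspace)
  have "continuous_map (Top G) euclidean f"
    using locally_constant_openin[OF f(2) refl, where P = "\<lambda>z. z \<in> U" for U]
    by (simp add: continuous_map_def)
  then show "f \<in> A_comp G c n"
    using f sub supp_locally_constant(2)[OF f(2) sub]
    by (simp add: A_comp_def Cc_def closure_of_closedin)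
qed

lemma subspace_A_comp: "cfun.subspace (A_comp G c n)"
proof (rule cfun.subspaceI)
  show "0 \<in> A_comp G c n"
    by (auto simp: A_comp_iff supp_def locally_constant_def)
next
  fix f g assume "f \<in> A_comp G c n" "g \<in> A_comp G c n"
  then have f: "supp f \<subseteq> fibre G c n" "locally_constant (Top G) f" "compactin (Top G) (supp f)"
    and g: "supp g \<subseteq> fibre G c n" "locally_constant (Top G) g" "compactin (Top G) (supp g)"
    by (auto simp: A_comp_iff)
  \<comment> \<open>Values may cancel, so this is only an inclusion; compactness of the smaller
    support comes from its being closed in the compact union.\<close>
  have sub: "supp (f + g) \<subseteq> supp f \<union> supp g" by (auto simp: supp_def)
  have lc: "locally_constant (Top G) (f + g)"
    unfolding locally_constant_def
  proof
    fix x assume "x \<in> arrows G"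
    then obtain U V where U: "openin (Top G) U" "x \<in> U" and fU: "\<And>y. y \<in> U \<Longrightarrow> f y = f x"
      and V: "openin (Top G) V" "x \<in> V" and gV: "\<And>y. y \<in> V \<Longrightarrow> g y = g x"
      using f(2) g(2) unfolding locally_constant_def by metis
    have "(f + g) y = (f + g) x" if "y \<in> U \<inter> V" for y
      using fU[of y] gV[of y] that by simp
    then show "\<exists>U. openin (Top G) U \<and> x \<in> U \<and> (\<forall>y\<in>U. (f + g) y = (f + g) x)"
      using U V by (intro exI[of _ "U \<inter> V"]) blast
  qed
  have compact: "compactin (Top G) (supp f \<union> supp g)"
    using f(3) g(3) by (rule compactin_Un)
  have "closedin (Top G) (supp (f + g))"
    using supp_locally_constant(2)[OF lc] sub compactin_subset_topspace[OF compact] by blast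
  then show "f + g \<in> A_comp G c n"
    using lc sub f g closed_compactin[OF compact sub] by (auto simp: A_comp_iff)
next
  fix z f assume f: "f \<in> A_comp G c n"
  have *: "supp (cscale z f) = (if z = 0 then {} else supp f)"
    by (auto simp: supp_def cscale_def)
  have "locally_constant (Top G) (cscale z f)"
    using f unfolding A_comp_iff locally_constant_def cscale_def by metis
  then show "cscale z f \<in> A_comp G c n"
    using f by (auto simp: A_comp_iff *)
qed

text \<open>In a Hausdorff space the compact set \<open>V\<close> is closed, so \<open>V\<close> and
  its complement are open sets on which the indicator is constant.\<close>

lemma indicator_in_A_comp:
  assumes open_V: "openin (Top G) V" and compact: "compactin (Top G) V"
    and "Hausdorff_space (Top G)" and V: "V \<subseteq> fibre G c n"
  shows "indicator V \<in> A_comp G c n"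
proof -
  have supp: "supp (indicator V) = V" by (auto simp: supp_def indicator_def)
  have "closedin (Top G) V"
    using assms compactin_imp_closedin by blast
  then have "openin (Top G) (arrows G - V)" by (simp add: closedin_def)
  then have "locally_constant (Top G) (indicator V)"
    unfolding locally_constant_def
  proof (intro ballI)
    fix x assume "x \<in> arrows G"
    then show "\<exists>U. openin (Top G) U \<and> x \<in> U \<and> (\<forall>y\<in>U. indicator V y = (indicator V x :: complex))"
      using open_V \<open>openin (Top G) (arrows G - V)\<close>
      by (cases "x \<in> V") (rule exI[of _ V], simp, rule exI[of _ "arrows G - V"], simp)
  qed
  then show ?thesis
    using V compact by (simp add: A_comp_iff supp)
qed

text \<open>This puts the cut-down function \<open>1_K * g\<close> in \<open>A(G)\<close> without a
  general proof that \<open>A(G)\<close> is closed under convolution.\<close>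

lemma A_comp_restrict:
  assumes f: "f \<in> A_comp G c n" and W: "openin (Top G) W" "closedin (Top G) W"
  shows "(\<lambda>a. if a \<in> W then f a else 0) \<in> A_comp G c n" (is "?f \<in> _")
proof -
  have fG: "supp f \<subseteq> fibre G c n" "locally_constant (Top G) f" "compactin (Top G) (supp f)"
    using f by (auto simp: A_comp_iff)
  have supp: "supp ?f = supp f \<inter> W" by (auto simp: supp_def)
  have "locally_constant (Top G) ?f"
    unfolding locally_constant_def
  proof
    fix x assume x: "x \<in> arrows G"
    show "\<exists>U. openin (Top G) U \<and> x \<in> U \<and> (\<forall>y\<in>U. ?f y = ?f x)"
    proof (cases "x \<in> W")
      case True
      obtain U where U: "openin (Top G) U" "x \<in> U" and fU: "\<And>y. y \<in> U \<Longrightarrow> f y = f x"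
        using fG(2) x unfolding locally_constant_def by metis
      have "?f y = ?f x" if "y \<in> U \<inter> W" for y
        using fU[of y] that True by simp
      then show ?thesis using U True W(1) by (intro exI[of _ "U \<inter> W"]) blast
    next
      case False
      then show ?thesis
        using x W(2) by (intro exI[of _ "arrows G - W"]) (auto simp: closedin_def)
    qed
  qed
  moreover have "compactin (Top G) (supp f \<inter> W)"
    using fG(3) W(2) by (rule compact_Int_closedin)
  ultimately show ?thesis
    using fG(1) by (auto simp: A_comp_iff supp)
qed

section \<open>Homogeneous components and graded kernels\<close>

lemma A_comp_imp_A_alg: "\<lbrakk>f \<in> A_comp G c n; n \<in> carrier \<Gamma>\<rbrakk> \<Longrightarrow> f \<in> A_alg G \<Gamma> c"
  unfolding A_alg_def by (intro cfun.span_base) blast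

text \<open>Induction over the span: a new multiple of some \<open>g\<close> of degree
  \<open>m\<close> is merged into the summand of degree \<open>m\<close>, so each degree keeps a
  single summand.\<close>

lemma A_alg_decompose:
  assumes "f \<in> A_alg G \<Gamma> c"
  shows "\<exists>N y. finite N \<and> N \<subseteq> carrier \<Gamma> \<and> (\<forall>n. y n \<in> A_comp G c n) \<and> f = (\<Sum>n\<in>N. y n)"
  using assms unfolding A_alg_def
proof (induction rule: cfun.span_induct_alt)
  case base
  show ?case
    using cfun.subspace_0[OF subspace_A_comp[of G c]]
    by (intro exI[of _ "{}"] exI[of _ "\<lambda>_. 0"]) (simp add: zero_fun_def)
next
  case (step z g f)
  then obtain N y m where N: "finite N" "N \<subseteq> carrier \<Gamma>" and y: "\<forall>n. y n \<in> A_comp G c n"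
    and f: "f = (\<Sum>n\<in>N. y n)" and m: "m \<in> carrier \<Gamma>" "g \<in> A_comp G c m"
    by auto
  define w where "w = (\<lambda>n. if n = m then cscale z g else 0)"
  \<comment> \<open>The case distinction discards \<open>y m\<close> when \<open>m\<close> is not in
    \<open>N\<close>, since that value does not enter \<open>f\<close>.\<close>
  define y' where "y' = (\<lambda>n. w n + (if n \<in> N then y n else 0))"
  have "y' n \<in> A_comp G c n" for n
    unfolding y'_def w_def using y m(2)
    by (auto intro!: cfun.subspace_add cfun.subspace_scale cfun.subspace_0 subspace_A_comp)
  moreover have "(\<Sum>n\<in>insert m N. y' n) = cscale z g + f"
  proof -
    have "(\<Sum>n\<in>insert m N. w n) = cscale z g"
      using N by (simp add: w_def)
    moreover have "(\<Sum>n\<in>insert m N. if n \<in> N then y n else 0) = f"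
      unfolding f using N(1) by (intro sum.mono_neutral_cong_right) auto
    ultimately show ?thesis
      by (simp only: y'_def sum.distrib)
  qed
  ultimately show ?case
    using N m by (intro exI[of _ "insert m N"] exI[of _ y']) auto
qed

text \<open>The images of the homogeneous parts of a kernel element decompose 0 in \<open>B\<close>.
  Uniqueness of decompositions makes each image zero, while some part is nonzero.\<close>

lemma ker_homogeneous:
  assumes B: "graded_complex_algebra \<Gamma> smul B"
    and \<pi>: "graded_hom G \<Gamma> c smul B \<pi>"
    and ker: "ker G \<Gamma> c \<pi> \<noteq> {0}"
  shows "\<exists>n\<in>carrier \<Gamma>. \<exists>g\<in>A_comp G c n. g \<noteq> 0 \<and> \<pi> g = 0"
proof -
  interpret graded_complex_algebra \<Gamma> smul B by fact
  have add: "\<pi> (f + g) = \<pi> f + \<pi> g" if "f \<in> A_alg G \<Gamma> c" "g \<in> A_alg G \<Gamma> c" for f g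
    using \<pi> that by (auto simp: graded_hom_def)
  have A0: "0 \<in> A_alg G \<Gamma> c" by (simp add: A_alg_def cfun.span_zero)
  have \<pi>0: "\<pi> 0 = 0" using add[OF A0 A0] by simp
  \<comment> \<open>Since 0 lies in the kernel, a kernel other than \<open>{0}\<close> has a nonzero
    element.\<close>
  then obtain f where f: "f \<in> A_alg G \<Gamma> c" "\<pi> f = 0" "f \<noteq> 0"
    using ker A0 by (auto simp: ker_def)
  obtain N y where N: "finite N" "N \<subseteq> carrier \<Gamma>" and y: "\<And>n. y n \<in> A_comp G c n"
    and f_eq: "f = (\<Sum>n\<in>N. y n)"
    using A_alg_decompose[OF f(1)] by blast
  have yA: "y n \<in> A_alg G \<Gamma> c" if "n \<in> N" for n
    using N(2) that by (intro A_comp_imp_A_alg[OF y]) auto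
  \<comment> \<open>\<open>\<pi>\<close> is additive only on \<open>A(G)\<close>, so the induction
    must check that the partial sums stay there.\<close>
  have \<pi>_sum: "\<pi> (\<Sum>n\<in>M. y n) = (\<Sum>n\<in>M. \<pi> (y n))" if "M \<subseteq> N" for M
    using finite_subset[OF that N(1)] that
  proof (induction M)
    case (insert n M)
    have "(\<Sum>n\<in>M. y n) \<in> A_alg G \<Gamma> c"
      using insert.prems yA unfolding A_alg_def by (intro cfun.span_sum) auto
    then have "\<pi> (y n + (\<Sum>n\<in>M. y n)) = \<pi> (y n) + \<pi> (\<Sum>n\<in>M. y n)"
      using insert.prems yA by (intro add) auto
    moreover have "\<pi> (\<Sum>n\<in>M. y n) = (\<Sum>n\<in>M. \<pi> (y n))"
      using insert by blast
    ultimately show ?case by (simp only: sum.insert[OF insert.hyps])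
  qed (simp only: \<pi>0 sum.empty)
  \<comment> \<open>Decompositions in \<open>direct_sum\<close> are families on the whole index
    type, hence the extension by 0.\<close>
  define x where "x = (\<lambda>n. if n \<in> N then \<pi> (y n) else 0)"
  have yB: "\<pi> (y n) \<in> B n" if "n \<in> N" for n
    using \<pi> y N that unfolding graded_hom_def image_subset_iff by blast
  have "0 = (\<Sum>n\<in>N. \<pi> (y n))" using f \<pi>_sum[OF order_refl] f_eq by simp
  also have "\<dots> = (\<Sum>n | x n \<noteq> 0. x n)"
    using N by (intro sum.mono_neutral_cong_right) (auto simp: x_def split: if_splits)
  finally have x_sum: "0 = (\<Sum>n | x n \<noteq> 0. x n)" .
  have x_fin: "finite {n. x n \<noteq> 0}"
    using N by (auto simp: x_def intro: finite_subset)
  have x_B: "(\<forall>n\<in>carrier \<Gamma>. x n \<in> B n) \<and> (\<forall>n. n \<notin> carrier \<Gamma> \<longrightarrow> x n = 0)"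
    using N yB subspace_0[OF subspace_component] by (auto simp: x_def)
  \<comment> \<open>Only uniqueness is extracted: every decomposition of 0 equals \<open>z\<close>.
    It is applied to \<open>x\<close> and to the zero family.\<close>
  obtain z where z: "\<And>x'. \<lbrakk>\<forall>n\<in>carrier \<Gamma>. x' n \<in> B n; \<forall>n. n \<notin> carrier \<Gamma> \<longrightarrow> x' n = 0;
      finite {n. x' n \<noteq> 0}; 0 = (\<Sum>n | x' n \<noteq> 0. x' n)\<rbrakk> \<Longrightarrow> x' = z"
    using direct_sum[of 0] by (elim ex1E) blast
  have "x = z"
    by (rule z) (use x_sum x_fin x_B in auto)
  also have "z = (\<lambda>_. 0)"
    by (rule z[symmetric]) (auto simp: subspace_0[OF subspace_component])
  finally have "x = (\<lambda>_. 0)" .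
  then have "\<pi> (y n) = 0" if "n \<in> N" for n
    using that by (metis x_def)
  moreover obtain n where "n \<in> N" "y n \<noteq> 0"
    using f(3) f_eq by (metis sum.neutral)
  ultimately show ?thesis using y N by blast
qed

section \<open>Ample groupoids\<close>

text \<open>This collects the topological hypotheses that mention neither the cocycle nor the
  grading. An ample groupoid is an etale one with totally disconnected unit space.\<close>

locale ample_groupoid = topological_groupoid +
  assumes locally_compact: "locally_compact_space (Top G)"
    and Hausdorff: "Hausdorff_space (Top G)"
    and clopen_basis: "has_clopen_basis (unit_space G)"
    and local_homeo: "local_homeomorphism (Top G) (unit_space G) (src G)"
begin

lemma local_homeoE:
  assumes "x \<in> arrows G"
  obtains U where "openin (Top G) U" "x \<in> U" "openin (unit_space G) (src G ` U)"
    "homeomorphic_map (subtopology (Top G) U) (subtopology (unit_space G) (src G ` U)) (src G)"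
    "inj_on (src G) U"
proof -
  obtain U where U: "openin (Top G) U" "x \<in> U" "openin (unit_space G) (src G ` U)"
    "homeomorphic_map (subtopology (Top G) U) (subtopology (unit_space G) (src G ` U)) (src G)"
    using local_homeo assms unfolding local_homeomorphism_def by blast
  have "topspace (subtopology (Top G) U) = U"
    using openin_subset[OF U(1)] by auto
  then have "inj_on (src G) U"
    using homeomorphic_imp_injective_map[OF U(4)] by simp
  then show thesis using U that by blast
qed

lemma openin_preimage:
  assumes "continuous_map (Top G) (Top G) h" "openin (Top G) U"
  shows "openin (Top G) {x \<in> arrows G. h x \<in> U}"
  using assms by (auto simp: continuous_map_def)

text \<open>Openness is local: near each point of \<open>W\<close> the source map is a homeomorphism
  onto an open set of units.\<close>

lemma openin_src_image:
  assumes W: "openin (Top G) W"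
  shows "openin (unit_space G) (src G ` W)"
proof (subst openin_subopen, intro ballI)
  fix v assume "v \<in> src G ` W"
  then obtain x where x: "x \<in> W" "v = src G x" by auto
  have "x \<in> arrows G" using x W openin_subset by blast
  then obtain U where U: "openin (Top G) U" "x \<in> U" "openin (unit_space G) (src G ` U)"
    "homeomorphic_map (subtopology (Top G) U) (subtopology (unit_space G) (src G ` U)) (src G)"
    using local_homeoE by metis
  have "openin (subtopology (Top G) U) (W \<inter> U)"
    using W by (auto simp: openin_subtopology)
  then have "openin (subtopology (unit_space G) (src G ` U)) (src G ` (W \<inter> U))"
    using homeomorphic_imp_open_map[OF U(4)] by (auto simp: open_map_def)
  then have "openin (unit_space G) (src G ` (W \<inter> U))"
    using U(3) openin_trans_full by blast
  then show "\<exists>T. openin (unit_space G) T \<and> v \<in> T \<and> T \<subseteq> src G ` W"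
    using x U by (intro exI[of _ "src G ` (W \<inter> U)"]) auto
qed

text \<open>An arrow close to a unit \<open>u\<close> has its source close to \<open>u\<close> as well, and \<open>src\<close> identifies it
  with that source; local injectivity makes them equal.\<close>

lemma openin_units: "openin (Top G) (units G)"
proof (subst openin_subopen, intro ballI)
  fix u assume u: "u \<in> units G"
  then obtain U where U: "openin (Top G) U" "u \<in> U" "inj_on (src G) U"
    using local_homeoE units_subset by (metis subsetD)
  let ?T = "U \<inter> {x \<in> arrows G. src G x \<in> U}"
  have "?T \<subseteq> units G"
  proof
    fix x assume x: "x \<in> ?T"
    then have "src G x = x"
      using U(3) src_src by (auto dest: inj_onD)
    then show "x \<in> units G" using x src_in_units by force
  qed
  moreover have "openin (Top G) ?T"
    using U(1) openin_preimage[OF continuous_src U(1)] by blast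
  ultimately show "\<exists>T. openin (Top G) T \<and> u \<in> T \<and> T \<subseteq> units G"
    using u U src_unit units_subset by (intro exI[of _ ?T]) auto
qed

lemma openin_unit_space_iff: "openin (unit_space G) U \<longleftrightarrow> openin (Top G) U \<and> U \<subseteq> units G"
  by (rule openin_open_subtopology[OF openin_units])

text \<open>Local compactness gives an open \<open>P\<close> around \<open>u\<close> inside a
  compact \<open>C\<close> within \<open>W\<close>. A clopen basis set inside \<open>P\<close> is a
  closed subset of \<open>C\<close>, hence compact.\<close>

lemma compact_open_neighbourhood:
  assumes W: "openin (unit_space G) W" and u: "u \<in> W"
  obtains K where "openin (Top G) K" "compactin (Top G) K" "u \<in> K" "K \<subseteq> W" "K \<subseteq> units G"
proof -
  have W': "openin (Top G) W" "W \<subseteq> units G"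
    using W by (simp_all add: openin_unit_space_iff)
  have "neighbourhood_base_of (compactin (Top G)) (Top G)"
    using locally_compact locally_compact_space_neighbourhood_base[OF disjI1[OF Hausdorff]] by simp
  then have "\<exists>P C. openin (Top G) P \<and> compactin (Top G) C \<and> u \<in> P \<and> P \<subseteq> C \<and> C \<subseteq> W"
    using W'(1) u by (simp add: neighbourhood_base_of)
  then obtain P C where P: "openin (Top G) P" "compactin (Top G) C" "u \<in> P" "P \<subseteq> C" "C \<subseteq> W"
    by metis
  have "openin (unit_space G) P"
    using P W' by (auto simp: openin_unit_space_iff)
  moreover obtain \<B> where \<B>: "\<And>U. U \<in> \<B> \<Longrightarrow> openin (unit_space G) U \<and> closedin (unit_space G) U"
    and "openin (unit_space G) = arbitrary union_of (\<lambda>U. U \<in> \<B>)"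
    using clopen_basis unfolding has_clopen_basis_def by metis
  ultimately obtain K where "K \<in> \<B>" and "u \<in> K" "K \<subseteq> P"
    using P(3) by (metis arbitrary_union_of_alt)
  then have K: "openin (unit_space G) K" "closedin (unit_space G) K" "u \<in> K" "K \<subseteq> P"
    using \<B> by auto
  have "compactin (unit_space G) C"
    using P W' by (auto simp: compactin_subtopology)
  then have "compactin (unit_space G) K"
    using K P closed_compactin by (metis order_trans)
  then show thesis
    using that[of K] K P by (auto simp: openin_unit_space_iff compactin_subtopology)
qed

text \<open>Inversion exchanges range and source, so a neighbourhood of \<open>ginv G x\<close> on
  which the source is injective pulls back to one of \<open>x\<close> on which the range is.\<close>

lemma bisection_neighbourhood:
  assumes x: "x \<in> arrows G"
  obtains V where "openin (Top G) V" "x \<in> V" "inj_on (rng G) V" "inj_on (src G) V"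
proof -
  obtain U where U: "openin (Top G) U" "x \<in> U" "inj_on (src G) U"
    using local_homeoE x by metis
  obtain U' where U': "openin (Top G) U'" "ginv G x \<in> U'" "inj_on (src G) U'"
    using local_homeoE ginv_closed[OF x] by metis
  let ?V = "U \<inter> {a \<in> arrows G. ginv G a \<in> U'}"
  have "inj_on (rng G) ?V"
  proof (rule inj_onI)
    fix a b assume ab: "a \<in> ?V" "b \<in> ?V" "rng G a = rng G b"
    then have "src G (ginv G a) = src G (ginv G b)" by (simp add: src_ginv)
    then have "ginv G a = ginv G b" using U'(3) ab by (auto dest: inj_onD)
    then show "a = b" using ab ginv_ginv by (metis (no_types, lifting) IntD2 mem_Collect_eq)
  qed
  moreover have "inj_on (src G) ?V" using U(3) by (auto intro: inj_on_subset)
  moreover have "openin (Top G) ?V"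
    using U(1) openin_preimage[OF continuous_ginv U'(1)] by blast
  ultimately show thesis using that[of ?V] x U U' by auto
qed

lemma openin_ginv_image:
  assumes V: "openin (Top G) V"
  shows "openin (Top G) (ginv G ` V)"
proof -
  have "ginv G ` V = {x \<in> arrows G. ginv G x \<in> V}"
  proof (intro equalityI subsetI)
    fix x assume "x \<in> {x \<in> arrows G. ginv G x \<in> V}"
    then show "x \<in> ginv G ` V" by (intro image_eqI[of _ _ "ginv G x"]) (auto simp: ginv_ginv)
  qed (use openin_subset[OF V] in \<open>auto simp: ginv_closed ginv_ginv\<close>)
  then show ?thesis using openin_preimage[OF continuous_ginv V] by simp
qed

text \<open>The map \<open>?h\<close> sends \<open>C\<close> to a compact, hence closed, subset of a
  Hausdorff product that misses the endpoints of \<open>x\<close>. A basic open box around them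
  avoids this image and shrinks to compact open sides.\<close>

lemma separate_endpoints:
  assumes C: "compactin (Top G) C" and x: "x \<in> arrows G"
    and sep: "\<And>a. \<lbrakk>a \<in> C; rng G a = rng G x\<rbrakk> \<Longrightarrow> src G a \<noteq> src G x"
  obtains K L where "openin (Top G) K" "compactin (Top G) K" "K \<subseteq> units G" "rng G x \<in> K"
    "openin (Top G) L" "compactin (Top G) L" "L \<subseteq> units G" "src G x \<in> L"
    "\<And>a. \<lbrakk>a \<in> C; rng G a \<in> K\<rbrakk> \<Longrightarrow> src G a \<notin> L"
proof -
  let ?h = "\<lambda>a. (rng G a, src G a)" and ?X = "prod_topology (unit_space G) (unit_space G)"
  have "continuous_map (Top G) ?X ?h"
    by (simp add: continuous_map_pairedI continuous_map_into_subtopology continuous_rng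
        continuous_src rng_in_units src_in_units Pi_iff)
  then have "compactin ?X (?h ` C)" using C image_compactin by blast
  moreover have "Hausdorff_space ?X"
    using Hausdorff by (simp add: Hausdorff_space_prod_topology Hausdorff_space_subtopology)
  ultimately have "closedin ?X (?h ` C)" using compactin_imp_closedin by blast
  then have "openin ?X (topspace ?X - ?h ` C)" by (rule openin_diff[OF openin_topspace])
  moreover have "?h x \<in> topspace ?X - ?h ` C"
  proof
    show "?h x \<in> topspace ?X"
      using x by (simp add: rng_in_units src_in_units rng_closed src_closed)
    show "?h x \<notin> ?h ` C"
    proof
      assume "?h x \<in> ?h ` C"
      then obtain a where "a \<in> C" "rng G a = rng G x" "src G a = src G x" by auto
      with sep[of a] show False by simp
    qed
  qed
  ultimately have "\<exists>P Q. openin (unit_space G) P \<and> openin (unit_space G) Q \<and>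
      rng G x \<in> P \<and> src G x \<in> Q \<and> P \<times> Q \<subseteq> topspace ?X - ?h ` C"
    by (rule openin_prod_topology_alt[THEN iffD1, rule_format])
  then obtain P Q where PQ: "openin (unit_space G) P" "openin (unit_space G) Q"
    "rng G x \<in> P" "src G x \<in> Q" "P \<times> Q \<subseteq> topspace ?X - ?h ` C"
    by (elim exE conjE)
  obtain K where K: "openin (Top G) K" "compactin (Top G) K" "rng G x \<in> K" "K \<subseteq> P" "K \<subseteq> units G"
    using compact_open_neighbourhood[OF PQ(1,3)] .
  obtain L where L: "openin (Top G) L" "compactin (Top G) L" "src G x \<in> L" "L \<subseteq> Q" "L \<subseteq> units G"
    using compact_open_neighbourhood[OF PQ(2,4)] .
  have KL: "src G a \<notin> L" if a: "a \<in> C" "rng G a \<in> K" for a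
  proof
    assume "src G a \<in> L"
    then have "?h a \<in> P \<times> Q" using a(2) K(4) L(4) by auto
    then show False using a(1) PQ(5) by blast
  qed
  show thesis by (rule that[OF K(1,2,5,3) L(1,2,5,3) KL])
qed

end

section \<open>From a kernel element to a compact open set of units\<close>

theorem theorem5p4:
  fixes \<Gamma> :: "('n, 'm) monoid_scheme"
    and G :: "'g topgroupoid"
    and c :: "'g \<Rightarrow> 'n"
    and smul :: "complex \<Rightarrow> 'b::ring \<Rightarrow> 'b"
    and B :: "'n \<Rightarrow> 'b set"
    and \<pi> :: "('g \<Rightarrow> complex) \<Rightarrow> 'b"
  assumes "group \<Gamma>"
    and "topological_groupoid G"
    and "locally_compact_space (Top G)"
    and "Hausdorff_space (Top G)"
    and "has_clopen_basis (unit_space G)"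
    and "local_homeomorphism (Top G) (unit_space G) (src G)"
    and "continuous_cocycle G \<Gamma> c"
    and "unit_space G closure_of {u \<in> units G. isotropy G (fibre G c \<one>\<^bsub>\<Gamma>\<^esub>) u = {u}} = units G"
    and "graded_complex_algebra \<Gamma> smul B"
    and "graded_hom G \<Gamma> c smul B \<pi>"
    and "ker G \<Gamma> c \<pi> \<noteq> {0}"
  shows "\<exists>K. K \<noteq> {} \<and> K \<subseteq> units G \<and> openin (unit_space G) K \<and> compactin (unit_space G) K \<and>
           \<pi> (indicator K) = 0"
proof -
  interpret \<Gamma>: group \<Gamma> by fact
  interpret graded_complex_algebra \<Gamma> smul B by fact
  interpret topological_groupoid G by fact
  interpret ample_groupoid G
    by unfold_locales fact+
  have c_carrier: "c a \<in> carrier \<Gamma>" if "a \<in> arrows G" for a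
    using assms(7) that by (auto simp: continuous_cocycle_def continuous_map_def)
  have c_mult: "c (mult G a b) = c a \<otimes>\<^bsub>\<Gamma>\<^esub> c b" if "(a, b) \<in> composable G" for a b
    using assms(7) that by (auto simp: continuous_cocycle_def)
  have c_unit: "c u = \<one>\<^bsub>\<Gamma>\<^esub>" if u: "u \<in> units G" for u
  proof -
    have uG: "u \<in> arrows G" "rng G u = u" using u by (auto simp: units_iff)
    then have "c u \<otimes>\<^bsub>\<Gamma>\<^esub> c u = c u"
      using c_mult[of u u] src_unit[OF u] rng_mult_id[of u] by (simp add: composable_def)
    then show ?thesis using c_carrier uG by simp
  qed
  have c_ginv: "c (ginv G a) \<otimes>\<^bsub>\<Gamma>\<^esub> c a = \<one>\<^bsub>\<Gamma>\<^esub>" if "a \<in> arrows G" for a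
    using c_mult[OF composable_ginv[OF that that refl]] c_unit that
    by (simp add: ginv_mult src_in_units)
  have \<pi>_scale: "\<pi> (cscale z f) = smul z (\<pi> f)" if "f \<in> A_alg G \<Gamma> c" for z f
    using assms(10) that by (auto simp: graded_hom_def)
  have \<pi>_conv: "\<pi> (convolution G f g) = \<pi> f * \<pi> g"
    if "f \<in> A_alg G \<Gamma> c" "g \<in> A_alg G \<Gamma> c" for f g
    using assms(10) that by (auto simp: graded_hom_def)
  obtain n g where n: "n \<in> carrier \<Gamma>" and gA: "g \<in> A_comp G c n" and "g \<noteq> 0" and \<pi>g: "\<pi> g = 0"
    using ker_homogeneous[OF assms(9-11)] by blast
  have g: "supp g \<subseteq> fibre G c n" "locally_constant (Top G) g" "compactin (Top G) (supp g)"
    using gA by (auto simp: A_comp_iff)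
  have g_arrows: "supp g \<subseteq> arrows G" using g(3) by (rule compactin_subset_topspace)
  have g_open: "openin (Top G) (supp g)"
    by (rule supp_locally_constant(1)[OF g(2) g_arrows])
  have "supp g \<noteq> {}" using \<open>g \<noteq> 0\<close> by (auto simp: supp_def fun_eq_iff)
  \<comment> \<open>The sources of \<open>supp g\<close> form a nonempty open set of units, which
    meets the dense set; \<open>x\<close> is a preimage of a point found there.\<close>
  then obtain x where x: "x \<in> supp g" and iso: "isotropy G (fibre G c \<one>\<^bsub>\<Gamma>\<^esub>) (src G x) = {src G x}"
  proof -
    obtain x0 where x0: "x0 \<in> supp g" using \<open>supp g \<noteq> {}\<close> by auto
    then have "src G x0 \<in> unit_space G closure_of {u \<in> units G. isotropy G (fibre G c \<one>\<^bsub>\<Gamma>\<^esub>) u = {u}}"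
      using assms(8) g_arrows src_in_units by auto
    then obtain v where "v \<in> src G ` supp g" "isotropy G (fibre G c \<one>\<^bsub>\<Gamma>\<^esub>) v = {v}"
      using openin_src_image[OF g_open] x0 unfolding in_closure_of by blast
    then show thesis using that by blast
  qed
  have xG: "x \<in> arrows G" using x g_arrows by auto
  \<comment> \<open>The product of \<open>ginv G x\<close> and \<open>a\<close> has degree
    \<open>e\<close>, since \<open>a\<close> and \<open>x\<close> both have degree \<open>n\<close>,
    and it begins and ends at the source of \<open>x\<close>. Trivial isotropy makes it a
    unit.\<close>
  have unique: "a = x" if a: "a \<in> supp g" "rng G a = rng G x" "src G a = src G x" for a
  proof -
    have aG: "a \<in> arrows G" using a g_arrows by auto
    have comp: "(ginv G x, a) \<in> composable G" using composable_ginv xG aG a by simp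
    have "c a = c x" using g(1) a(1) x by (auto simp: fibre_def)
    then have "c (mult G (ginv G x) a) = \<one>\<^bsub>\<Gamma>\<^esub>"
      using c_mult[OF comp] c_ginv[OF xG] by simp
    then have "mult G (ginv G x) a \<in> isotropy G (fibre G c \<one>\<^bsub>\<Gamma>\<^esub>) (src G x)"
      using mult_closed[OF comp] rng_mult[OF comp] src_mult[OF comp] a xG
      by (simp add: isotropy_def fibre_def rng_ginv)
    then have "mult G (ginv G x) a = src G x" using iso by auto
    then show ?thesis
      using mult_ginv_mult[OF xG aG] a mult_src_id[OF xG] by simp
  qed
  obtain U where U: "openin (Top G) U" "x \<in> U" "inj_on (rng G) U" "inj_on (src G) U"
    using bisection_neighbourhood[OF xG] .
  obtain U' where U': "openin (Top G) U'" "x \<in> U'" "\<forall>y\<in>U'. g y = g x"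
    using g(2) xG unfolding locally_constant_def by blast
  \<comment> \<open>Removing \<open>U \<inter> U'\<close> deletes \<open>x\<close>, so by
    \<open>unique\<close> no remaining arrow of the support shares both endpoints with
    \<open>x\<close>.\<close>
  have "compactin (Top G) (supp g - (U \<inter> U'))"
    using g(3) U U' compactin_imp_closedin Hausdorff
    by (intro closed_compactin[OF g(3)] closedin_diff) auto
  moreover have "src G a \<noteq> src G x" if "a \<in> supp g - (U \<inter> U')" "rng G a = rng G x" for a
    using unique that U U' by blast
  ultimately obtain K L where
    K: "openin (Top G) K" "compactin (Top G) K" "K \<subseteq> units G" "rng G x \<in> K" and
    L: "openin (Top G) L" "compactin (Top G) L" "L \<subseteq> units G" "src G x \<in> L" and
    KL: "\<And>a. \<lbrakk>a \<in> supp g - (U \<inter> U'); rng G a \<in> K\<rbrakk> \<Longrightarrow> src G a \<notin> L"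
    using separate_endpoints[OF _ xG] by metis
  \<comment> \<open>This is the support of \<open>1_K * g * 1_L\<close>. By \<open>KL\<close> it
    lies in \<open>U \<inter> U'\<close>, where range and source are injective and \<open>g\<close>
    has the constant value \<open>g x\<close>.\<close>
  define V where "V = supp g \<inter> {a \<in> arrows G. rng G a \<in> K} \<inter> {a \<in> arrows G. src G a \<in> L}"
  have VU: "V \<subseteq> U \<inter> U'" using KL by (auto simp: V_def)
  have V_open: "openin (Top G) V"
    unfolding V_def using g_open openin_preimage[OF continuous_rng K(1)]
      openin_preimage[OF continuous_src L(1)] by blast
  have V_arrows: "V \<subseteq> arrows G" using V_open by (rule openin_subset)
  have "closedin (Top G) K" "closedin (Top G) L"
    using K L Hausdorff compactin_imp_closedin by blast+
  then have rK_closed: "closedin (Top G) {a \<in> arrows G. rng G a \<in> K}"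
    and sL_closed: "closedin (Top G) {a \<in> arrows G. src G a \<in> L}"
    using continuous_rng continuous_src by (auto simp: continuous_map_closedin)
  have V_compact: "compactin (Top G) V"
    unfolding V_def by (intro compact_Int_closedin g(3) rK_closed sL_closed)
  have V_fibre: "V \<subseteq> fibre G c n" using g(1) by (auto simp: V_def)
  have V_inj: "inj_on (rng G) V" "inj_on (src G) V"
    using U VU by (auto intro: inj_on_subset)
  have unit_indicator: "indicator M \<in> A_alg G \<Gamma> c"
    if "openin (Top G) M" "compactin (Top G) M" "M \<subseteq> units G" for M
  proof -
    have "M \<subseteq> fibre G c \<one>\<^bsub>\<Gamma>\<^esub>"
      using that(3) units_subset c_unit by (auto simp: fibre_def)
    then show ?thesis
      by (rule A_comp_imp_A_alg[OF indicator_in_A_comp[OF that(1,2) Hausdorff] \<Gamma>.one_closed])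
  qed
  have V_A: "indicator V \<in> A_alg G \<Gamma> c"
    by (rule A_comp_imp_A_alg[OF indicator_in_A_comp[OF V_open V_compact Hausdorff V_fibre] n])
  have "ginv G ` V \<subseteq> fibre G c (inv\<^bsub>\<Gamma>\<^esub> n)"
  proof (intro image_subsetI)
    fix a assume a: "a \<in> V"
    then have aG: "a \<in> arrows G" and "c a = n" using V_fibre by (auto simp: fibre_def)
    then have "c (ginv G a) = inv\<^bsub>\<Gamma>\<^esub> n"
      using c_ginv[OF aG] n c_carrier ginv_closed \<Gamma>.inv_equality by metis
    then show "ginv G a \<in> fibre G c (inv\<^bsub>\<Gamma>\<^esub> n)"
      using aG by (simp add: fibre_def ginv_closed)
  qed
  then have V'_A: "indicator (ginv G ` V) \<in> A_alg G \<Gamma> c"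
    by (rule A_comp_imp_A_alg[OF indicator_in_A_comp[OF openin_ginv_image[OF V_open]
          image_compactin[OF V_compact continuous_ginv] Hausdorff] \<Gamma>.inv_closed[OF n]])
  have supp_cut: "supp (\<lambda>a. indicator K (rng G a) * g a) \<subseteq> arrows G"
    using g_arrows by (auto simp: supp_def)
  have "convolution G (convolution G (indicator K) g) (indicator L)
      = (\<lambda>a. indicator K (rng G a) * g a * indicator L (src G a))"
    by (simp only: convolution_indicator_left[OF K(3) g_arrows]
        convolution_indicator_right[OF L(3) supp_cut])
  also have "\<dots> = cscale (g x) (indicator V)"
  proof
    fix a
    show "indicator K (rng G a) * g a * indicator L (src G a) = cscale (g x) (indicator V) a"
    proof (cases "a \<in> V")
      case True
      then have "g a = g x" using VU U' by blast
      then show ?thesis using True by (simp add: V_def cscale_def)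
    next
      case False
      then show ?thesis
        using g_arrows by (auto simp: V_def cscale_def supp_def indicator_def)
    qed
  qed
  finally have cut: "convolution G (convolution G (indicator K) g) (indicator L)
    = cscale (g x) (indicator V)" .
  have gA': "g \<in> A_alg G \<Gamma> c" using gA n by (rule A_comp_imp_A_alg)
  \<comment> \<open>\<open>\<pi>\<close> is multiplicative only on \<open>A(G)\<close>. Only the
    inner product needs this check, as the outer one is a multiple of \<open>1_V\<close>.\<close>
  have cutA: "convolution G (indicator K) g \<in> A_alg G \<Gamma> c"
  proof -
    have "(\<lambda>a. indicator K (rng G a) * g a)
        = (\<lambda>a. if a \<in> {a \<in> arrows G. rng G a \<in> K} then g a else 0)"
      using g_arrows by (auto simp: fun_eq_iff supp_def indicator_def)
    also have "\<dots> \<in> A_comp G c n"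
      by (rule A_comp_restrict[OF gA openin_preimage[OF continuous_rng K(1)] rK_closed])
    finally show ?thesis
      using n unfolding convolution_indicator_left[OF K(3) g_arrows] by (rule A_comp_imp_A_alg)
  qed
  have "smul (g x) (\<pi> (indicator V)) = 0"
    using \<pi>_conv[OF cutA unit_indicator[OF L(1-3)]] \<pi>_conv[OF unit_indicator[OF K(1-3)] gA']
      \<pi>g cut \<pi>_scale[OF V_A] by simp
  \<comment> \<open>The scalar \<open>g x\<close> is nonzero because \<open>x\<close> lies in the
    support of \<open>g\<close>.\<close>
  then have \<pi>V: "\<pi> (indicator V) = 0"
    using x by (simp add: supp_def)
  have "\<pi> (indicator (src G ` V)) = 0"
    using \<pi>_conv[OF V'_A V_A] convolution_indicator_ginv[OF V_arrows V_inj] \<pi>V by simp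
  moreover have "compactin (unit_space G) (src G ` V)"
    using image_compactin[OF V_compact continuous_src] V_arrows
    by (auto simp: compactin_subtopology src_in_units)
  moreover have "src G ` V \<noteq> {}" using x xG K L by (auto simp: V_def)
  ultimately show ?thesis
    using openin_src_image[OF V_open] V_arrows by (intro exI[of _ "src G ` V"]) (auto simp: src_in_units)
qed

end
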